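(* There are no distance-regular graphs with any of the following intersection arrays: \begin{enumerate} \item[(i)] $\{55,36,11;1,4,45\}$, \item[(ii)] $\{56,36,9;1,3,48\}$, \item[(iii)] $\{65,44,11;1,4,55\}$, \item[(iv)] $\{81,56,24,1;1,3,56,81\}$, \item[(v)] $\{117,80,32,1;1,4,80,117\}$, \item[(vi)] $\{117,80,30,1;1,6,80,117\}$, \item[(vii)] $\{189,128,45,1;1,9,128,189\}$. \end{enumerate}
   Context: All graphs are finite, undirected and simple. A connected graph $\Gamma$ of diameter $D$ is distance-regular if there are integers $b_i,c_i$ ($0\le i\le D$) such that for any vertices $x,y$ at distance $i$ there are precisely $c_i$ neighbors of $y$ at distance $i-1$ from $x$ and $b_i$ neighbors of $y$ at distance $i+1$ from $x$. Its intersection array is $\{b_0,b_1,\dots,b_{D-1};c_1,c_2,\dots,c_D\}$. *)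

theory Defs
  imports "Graph_Theory.Graph_Theory"
begin

text \<open>
  Finite undirected simple graphs are the locale \<open>graph\<close> of \<open>Graph_Theory\<close>: finite, symmetric,
  loop-free digraphs without parallel arcs, so each undirected edge is a pair of opposite arcs.
  The library's \<open>connected\<close> requires a nonempty vertex set.
\<close>

text \<open>
  The path metric: \<open>\<mu>\<close> is the infimum of the costs of all walks, which for unit weights are their
  lengths. The value is \<open>\<infinity>\<close> if there is no walk.
\<close>
definition graph_dist :: "('a, 'b) pre_digraph \<Rightarrow> 'a \<Rightarrow> 'a \<Rightarrow> ereal" where
  "graph_dist G x y = wf_digraph.\<mu> G (\<lambda>_. 1) x y"

definition graph_diameter :: "('a, 'b) pre_digraph \<Rightarrow> ereal" where
  "graph_diameter G = (SUP x\<in>verts G. SUP y\<in>verts G. graph_dist G x y)"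

text \<open>
  For \<open>i = 0\<close> the first set is empty, as no distance equals \<open>- 1\<close>. No bound \<open>i \<le> D\<close> is needed,
  since distances never exceed the diameter; \<open>b\<close> and \<open>c\<close> are unconstrained beyond \<open>D\<close>.
\<close>
definition intersection_numbers ::
    "('a, 'b) pre_digraph \<Rightarrow> (nat \<Rightarrow> nat) \<Rightarrow> (nat \<Rightarrow> nat) \<Rightarrow> bool" where
  "intersection_numbers G b c \<longleftrightarrow>
    (\<forall>i. \<forall>x\<in>verts G. \<forall>y\<in>verts G. graph_dist G x y = ereal (real i) \<longrightarrow>
      card {z \<in> verts G. y \<rightarrow>\<^bsub>G\<^esub> z \<and> graph_dist G x z = ereal (real i - 1)} = c i \<and>
      card {z \<in> verts G. y \<rightarrow>\<^bsub>G\<^esub> z \<and> graph_dist G x z = ereal (real i + 1)} = b i)"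

definition distance_regular :: "('a, 'b) pre_digraph \<Rightarrow> bool" where
  "distance_regular G \<longleftrightarrow>
    graph G \<and> Digraph_Component.connected G \<and> (\<exists>b c. intersection_numbers G b c)"

text \<open>The array \<open>{b\<^sub>0, \<dots>, b\<^sub>D\<^sub>-\<^sub>1; c\<^sub>1, \<dots>, c\<^sub>D}\<close> is given by its two halves as lists.\<close>
definition has_intersection_array :: "('a, 'b) pre_digraph \<Rightarrow> nat list \<Rightarrow> nat list \<Rightarrow> bool" where
  "has_intersection_array G bs cs \<longleftrightarrow>
    (\<exists>D b c. graph_diameter G = ereal (real D) \<and> intersection_numbers G b c \<and>
      bs = map b [0..<D] \<and> cs = map c [1..<Suc D])"

end

(*
  A distance-regular graph with c_1 = 1 is amply regular: with k = b_0, l = b_0 - b_1 - 1 and m = c_2,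
  it is k-regular, adjacent vertices have l common neighbours, and vertices at distance two have m.
  By inclusion-exclusion (Koolen and Park), four pairwise nonadjacent neighbours of a vertex x would
  force 4 (l + 1) <= k + 6 (m - 1), which fails for all seven arrays. Hence, given two nonadjacent
  neighbours of x, the neighbours of x adjacent to neither of them form a clique with at least
  k - 2 (l + 1) points. This is more than the l + 1 points possible for (iii) - (vii).

  For (i) and (ii) the large maximal cliques ("lines") have almost l + 2 points, and every edge is in
  exactly one of them. Every point x is on three lines L, with the sum of |L| - 1 equal to k, which
  leaves few possibilities for their sizes. Counting incident pairs of a point and a line of each size
  gives divisibility conditions that contradict the numbers of vertices, 672 and 855.
*)
theory Submission
  imports Defs
begin

section \<open>Two counting principles for finite set families\<close>

text \<open>Second Bonferroni inequality with uniform bounds: a new set overlaps the union of the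
  earlier ones in at most \<open>card S * m\<close> points, and these losses add up to
  \<open>card S choose 2\<close> multiples of \<open>m\<close>. The correction stands on the right
  to avoid truncated subtraction.\<close>

lemma card_UN_Bonferroni:
  assumes "finite S" "\<And>y. y \<in> S \<Longrightarrow> finite (A y)" "\<And>y. y \<in> S \<Longrightarrow> r \<le> card (A y)"
    and "\<And>y z. \<lbrakk>y \<in> S; z \<in> S; y \<noteq> z\<rbrakk> \<Longrightarrow> card (A y \<inter> A z) \<le> m"
  shows "card S * r \<le> card (\<Union>y\<in>S. A y) + (card S choose 2) * m"
  using assms
proof (induction S rule: finite_induct)
  case empty
  then show ?case by simp
next
  case (insert y S)
  have IH: "card S * r \<le> card (\<Union>z\<in>S. A z) + (card S choose 2) * m"
    using insert by simp
  have "card (A y \<inter> (\<Union>z\<in>S. A z)) \<le> (\<Sum>z\<in>S. card (A y \<inter> A z))"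
    using card_UN_le[OF insert.hyps(1), of "\<lambda>z. A y \<inter> A z"] by (simp only: Int_UN_distrib)
  also have "\<dots> \<le> card S * m"
    using insert.prems(3) insert.hyps by (intro order.trans[OF sum_bounded_above[of S _ m]]) auto
  finally have "card (A y \<inter> (\<Union>z\<in>S. A z)) \<le> card S * m" .
  moreover have "card (A y) + card (\<Union>z\<in>S. A z) =
      card (\<Union>z\<in>insert y S. A z) + card (A y \<inter> (\<Union>z\<in>S. A z))"
    using insert.prems(1) insert.hyps by (subst card_Un_Int) auto
  moreover have "r \<le> card (A y)"
    using insert.prems(2) by simp
  moreover have "Suc (card S) choose 2 = card S + (card S choose 2)"
    by (simp add: numeral_2_eq_2)
  ultimately show ?case
    using IH insert.hyps by (simp add: algebra_simps)
qed

lemma sum_card_incident_eq: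
  assumes "finite V" "finite \<L>" "\<And>Q. Q \<in> \<L> \<Longrightarrow> Q \<subseteq> V \<and> card Q = s"
  shows "(\<Sum>x\<in>V. card {Q \<in> \<L>. x \<in> Q}) = s * card \<L>"
proof -
  have "{x \<in> V. x \<in> Q} = Q" if "Q \<in> \<L>" for Q
    using assms(3)[OF that] by blast
  then show ?thesis
    using assms(3) by (subst sum_multicount[OF assms(1,2), where k = s]) auto
qed

section \<open>Amply regular graphs: cliques and cocliques\<close>

text \<open>The common neighbour \<open>w\<close> in \<open>common_nonadj\<close> expresses distance
  two without a metric.\<close>

locale amply_regular =
  fixes V :: "'a set" and adj :: "'a \<Rightarrow> 'a \<Rightarrow> bool" and k l m :: nat
  assumes finite_V: "finite V"
    and adj_V: "adj x y \<Longrightarrow> y \<in> V"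
    and adj_sym: "adj x y \<Longrightarrow> adj y x"
    and adj_irrefl: "\<not> adj x x"
    and valency: "x \<in> V \<Longrightarrow> card {y. adj x y} = k"
    and common_adj: "adj x y \<Longrightarrow> card {z. adj x z \<and> adj y z} = l"
    and common_nonadj: "\<lbrakk>x \<noteq> y; \<not> adj x y; adj x w; adj y w\<rbrakk> \<Longrightarrow> card {z. adj x z \<and> adj y z} = m"
begin

lemma finite_adj: "finite {y. adj x y}"
  by (rule finite_subset[OF _ finite_V]) (auto dest: adj_V)

lemma finite_sub_adj: "finite {z. adj x z \<and> P z}"
  by (rule finite_subset[OF _ finite_adj[of x]]) auto

definition clique :: "'a set \<Rightarrow> bool" where
  "clique Q \<longleftrightarrow> Q \<subseteq> V \<and> (\<forall>x\<in>Q. \<forall>y\<in>Q. x \<noteq> y \<longrightarrow> adj x y)"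

lemma finite_clique: "clique Q \<Longrightarrow> finite Q"
  using finite_V by (auto simp: clique_def intro: finite_subset)

lemma clique_card_le:
  assumes "clique Q" "x \<in> Q" "y \<in> Q" "x \<noteq> y"
  shows "card Q \<le> l + 2"
proof -
  have "card (Q - {x, y}) \<le> card {z. adj x z \<and> adj y z}"
    using assms by (intro card_mono finite_sub_adj) (auto simp: clique_def)
  also have "\<dots> = l"
    using assms by (intro common_adj) (auto simp: clique_def)
  finally show ?thesis
    using assms finite_clique[OF assms(1)] by (simp add: card_Diff_subset)
qed

text \<open>Inside the neighbourhood of \<open>x\<close>, the closed neighbourhoods of the points of
  \<open>S\<close> have \<open>l + 1\<close> points each. Two of them share at most
  \<open>m - 1\<close>, as \<open>x\<close> itself is one of the \<open>m\<close> common neighbours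
  of their centres. Bonferroni bounds the size of their union, which is at most
  \<open>k\<close>.\<close>

lemma coclique_bound:
  assumes "S \<subseteq> {y. adj x y}" "\<And>y z. \<lbrakk>y \<in> S; z \<in> S\<rbrakk> \<Longrightarrow> \<not> adj y z"
  shows "card S * (l + 1) \<le> k + (card S choose 2) * (m - 1)"
proof (cases "S = {}")
  case False
  then obtain s where "s \<in> S" by blast
  then have xV: "x \<in> V"
    using assms(1) adj_V adj_sym by blast
  define A where "A y = insert y {z. adj x z \<and> adj y z}" for y
  have finA: "finite (A y)" for y
    by (simp add: A_def finite_sub_adj)
  have cardA: "card (A y) = l + 1" if "y \<in> S" for y
    using that assms(1) common_adj adj_irrefl by (auto simp: A_def finite_sub_adj)
  have "card (A y \<inter> A z) \<le> m - 1" if "y \<in> S" "z \<in> S" "y \<noteq> z" for y z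
  proof -
    have adj: "adj y x" "adj z x" "\<not> adj y z" "\<not> adj z y"
      using that assms adj_sym by blast+
    have "A y \<inter> A z \<subseteq> {w. adj y w \<and> adj z w} - {x}"
      using that adj adj_irrefl by (auto simp: A_def)
    then have "card (A y \<inter> A z) \<le> card ({w. adj y w \<and> adj z w} - {x})"
      by (intro card_mono) (auto simp: finite_sub_adj)
    also have "\<dots> = m - 1"
      using adj that common_nonadj[of y z x] by (simp add: finite_sub_adj)
    finally show ?thesis .
  qed
  then have "card S * (l + 1) \<le> card (\<Union>y\<in>S. A y) + (card S choose 2) * (m - 1)"
    using assms(1) cardA finA
    by (intro card_UN_Bonferroni) (auto intro: finite_subset[OF _ finite_adj[of x]])
  moreover have "card (\<Union>y\<in>S. A y) \<le> card {y. adj x y}"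
    using assms(1) by (intro card_mono finite_adj) (auto simp: A_def)
  ultimately show ?thesis
    using valency[OF xV] by linarith
qed simp

end

section \<open>Neighbourhoods without cocliques of size four, and their large cliques\<close>

text \<open>\<open>no_4_coclique\<close> negates \<open>coclique_bound\<close> for four points, with
  \<open>6 = 4 choose 2\<close>. By \<open>valency_large\<close>, the non-neighbours of
  \<open>y\<close> among the neighbours of \<open>x\<close> are too many to form a clique with
  \<open>x\<close>.\<close>

locale coclique_free_amply_regular = amply_regular +
  assumes no_4_coclique: "k + 6 * (m - 1) < 4 * (l + 1)"
    and valency_large: "2 * (l + 1) < k"
begin

lemma common_nonneighbours_adj:
  assumes "y1 \<noteq> y2" "\<not> adj y1 y2" "z \<noteq> w" "{y1, y2, z, w} \<subseteq> {y. adj x y}"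
    and "{z, w} \<inter> (insert y1 {y. adj y1 y} \<union> insert y2 {y. adj y2 y}) = {}"
  shows "adj z w"
proof (rule ccontr)
  assume "\<not> adj z w"
  moreover have "\<not> adj y1 z" "\<not> adj y1 w" "\<not> adj y2 z" "\<not> adj y2 w"
    using assms(5) by blast+
  moreover have "\<not> adj v u" if "\<not> adj u v" for u v
    using that adj_sym by blast
  ultimately have "\<not> adj u v" if "u \<in> {y1, y2, z, w}" "v \<in> {y1, y2, z, w}" for u v
    using that assms(2) adj_irrefl by (elim insertE emptyE; simp)
  then have "card {y1, y2, z, w} * (l + 1) \<le> k + (card {y1, y2, z, w} choose 2) * (m - 1)"
    using assms(4) by (intro coclique_bound)
  moreover have "card {y1, y2, z, w} = 4"
    using assms by auto
  moreover have "(4::nat) choose 2 = 6"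
    by (simp add: numeral_eq_Suc)
  ultimately show False
    using no_4_coclique by simp
qed

lemma card_nonneighbours:
  assumes "adj x y"
  shows "card ({z. adj x z} - insert y {z. adj y z}) = k - (l + 1)"
proof -
  have "{z. adj x z} - insert y {z. adj y z} = {z. adj x z} - insert y {z. adj x z \<and> adj y z}"
    by auto
  also have "card \<dots> = card {z. adj x z} - card (insert y {z. adj x z \<and> adj y z})"
    using assms by (intro card_Diff_subset) (auto simp: finite_sub_adj)
  also have "\<dots> = k - (l + 1)"
    using assms valency[OF adj_V[OF adj_sym[OF assms]]] common_adj[OF assms] adj_irrefl
    by (simp add: finite_sub_adj)
  finally show ?thesis .
qed

text \<open>Two nonadjacent neighbours \<open>y1\<close>, \<open>y2\<close> of \<open>x\<close> are
  chosen among the non-neighbours of \<open>y\<close>. The neighbours of \<open>x\<close> adjacent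
  to neither then form a clique containing \<open>y\<close>, since a nonadjacent pair among them
  would complete a 4-coclique.\<close>

lemma ex_large_clique:
  assumes "adj x y"
  shows "\<exists>Q. clique Q \<and> x \<in> Q \<and> y \<in> Q \<and> k < card Q + 2 * (l + 1)"
proof -
  define N where "N u = {z. adj x z} - insert u {z. adj u z}" for u
  have xV: "x \<in> V"
    using assms adj_V adj_sym by blast
  have finN: "finite (N u)" for u
    by (simp add: N_def finite_adj)
  \<comment> \<open>This set has \<open>k - l\<close> points, more than the \<open>l + 2\<close>
    allowed for a clique.\<close>
  have "\<not> clique (insert x (N y))"
  proof
    assume *: "clique (insert x (N y))"
    have "N y \<noteq> {}"
      using card_nonneighbours[OF assms] valency_large unfolding N_def[symmetric] by auto
    then obtain u where u: "u \<in> N y" by blast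
    then have "u \<noteq> x"
      using adj_irrefl by (auto simp: N_def)
    then have "card (insert x (N y)) \<le> l + 2"
      using u * by (intro clique_card_le[of _ x u]) auto
    then have "card (N y) \<le> l + 1"
      using finN adj_irrefl by (auto simp: N_def)
    then show False
      using card_nonneighbours[OF assms] valency_large unfolding N_def[symmetric] by simp
  qed
  then obtain y1 y2 where y12: "y1 \<in> N y" "y2 \<in> N y" "y1 \<noteq> y2" "\<not> adj y1 y2"
    using xV by (auto simp: clique_def N_def intro: adj_sym dest: adj_V)
  have x12: "adj x y1" "adj x y2"
    using y12 by (auto simp: N_def)
  define C where "C = N y1 \<inter> N y2"
  have adjC: "adj z w" if "z \<in> C" "w \<in> C" "z \<noteq> w" for z w
    using that y12 by (intro common_nonneighbours_adj[of y1 y2 z w x]) (auto simp: C_def N_def)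
  have "C \<subseteq> {z. adj x z}"
    by (auto simp: C_def N_def)
  then have "clique (insert x C)"
    using adjC xV adj_V adj_sym unfolding clique_def by blast
  moreover have "y \<in> C"
    using y12 assms by (auto simp: C_def N_def dest: adj_sym)
  \<comment> \<open>\<open>N y1\<close> and \<open>N y2\<close> have \<open>k - (l + 1)\<close>
    points each inside a set of \<open>k\<close> points, so they share at least
    \<open>k - 2 * (l + 1)\<close>; adding \<open>x\<close> makes the inequality strict.\<close>
  moreover have "k < card (insert x C) + 2 * (l + 1)"
  proof -
    have "card (N y1) + card (N y2) = card (N y1 \<union> N y2) + card C"
      unfolding C_def by (rule card_Un_Int[OF finN finN])
    moreover have "card (N y1 \<union> N y2) \<le> card {z. adj x z}"
      by (intro card_mono finite_adj) (auto simp: N_def)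
    moreover have "x \<notin> C"
      using adj_irrefl by (auto simp: C_def N_def)
    ultimately show ?thesis
      using card_nonneighbours[OF x12(1)] card_nonneighbours[OF x12(2)] valency_large
        valency[OF xV] finN unfolding N_def[symmetric] by (simp add: C_def)
  qed
  ultimately show ?thesis
    by blast
qed

text \<open>A clique from \<open>ex_large_clique\<close> has more than
  \<open>k - 2 * (l + 1)\<close> points, but at most \<open>l + 2\<close> by
  \<open>clique_card_le\<close>.\<close>

lemma valency_le:
  assumes "V \<noteq> {}"
  shows "k \<le> 3 * (l + 1)"
proof -
  obtain x where x: "x \<in> V"
    using assms by blast
  have "{y. adj x y} \<noteq> {}"
    using valency[OF x] valency_large by (metis card.empty not_less_zero)
  then obtain y where "adj x y" by blast
  then obtain Q where Q: "clique Q" "x \<in> Q" "y \<in> Q" "k < card Q + 2 * (l + 1)"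
    using ex_large_clique by blast
  moreover have "x \<noteq> y"
    using \<open>adj x y\<close> adj_irrefl by blast
  ultimately show ?thesis
    using clique_card_le[of Q x y] by simp
qed

end

section \<open>Lines: large maximal cliques that partition the edges\<close>

text \<open>
  The extra inequality makes two large cliques through a common edge too big to lie in the common
  neighbourhood of its ends unless their union is a clique.
\<close>
locale linear_amply_regular = coclique_free_amply_regular +
  assumes valency_very_large: "5 * l + m + 4 < 2 * k"
begin

text \<open>The middle condition is maximality among cliques; the size threshold is the one reached
  in \<open>ex_large_clique\<close>.\<close>

definition lines :: "'a set set" where
  "lines = {Q. clique Q \<and> (\<forall>z\<in>V - Q. \<exists>q\<in>Q. \<not> adj z q) \<and> k < card Q + 2 * (l + 1)}"

lemma finite_lines: "finite lines"
  by (rule finite_subset[of _ "Pow V"]) (auto simp: lines_def clique_def finite_V)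

lemma line_clique: "Q \<in> lines \<Longrightarrow> clique Q"
  by (simp add: lines_def)

lemma line_card_ge: "Q \<in> lines \<Longrightarrow> k < card Q + 2 * (l + 1)"
  by (simp add: lines_def)

lemma line_maximal: "\<lbrakk>Q \<in> lines; z \<in> V; z \<notin> Q\<rbrakk> \<Longrightarrow> \<exists>q\<in>Q. \<not> adj z q"
  by (simp add: lines_def)

lemma line_card_le:
  assumes "Q \<in> lines"
  shows "card Q \<le> l + 2"
proof (cases "\<exists>x\<in>Q. \<exists>y\<in>Q. x \<noteq> y")
  case False
  then have "is_singleton Q \<or> Q = {}"
    by (metis is_singletonI')
  then show ?thesis
    by (auto simp: is_singleton_altdef)
qed (use clique_card_le line_clique[OF assms] in blast)

lemma ex_line:
  assumes "adj x y"
  shows "\<exists>Q\<in>lines. x \<in> Q \<and> y \<in> Q"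
proof -
  obtain Q where Q: "clique Q" "x \<in> Q" "y \<in> Q" "k < card Q + 2 * (l + 1)"
    using ex_large_clique[OF assms] by blast
  have "finite {M. clique M}"
    by (rule finite_subset[of _ "Pow V"]) (auto simp: clique_def finite_V)
  then obtain M where M: "clique M" "Q \<subseteq> M" "\<And>M'. clique M' \<Longrightarrow> M \<subseteq> M' \<Longrightarrow> M = M'"
    using finite_has_maximal2[of "{M. clique M}" Q] Q(1) by auto
  have "\<exists>q\<in>M. \<not> adj z q" if "z \<in> V - M" for z
  proof (rule ccontr)
    assume "\<not> ?thesis"
    then have "clique (insert z M)"
      using M(1) that by (auto simp: clique_def intro: adj_sym)
    then show False
      using M(3)[of "insert z M"] that by blast
  qed
  moreover have "card Q \<le> card M"
    using M by (intro card_mono finite_clique)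
  ultimately have "M \<in> lines"
    using M Q by (auto simp: lines_def)
  then show ?thesis
    using M Q by blast
qed

text \<open>By maximality some \<open>q\<close> on the line is not adjacent to \<open>y\<close>. The
  neighbours of \<open>y\<close> on the line are then common neighbours of \<open>q\<close> and
  \<open>y\<close>, which are at distance two through \<open>x\<close>.\<close>

lemma card_line_Int_adj_le:
  assumes "Q \<in> lines" "x \<in> Q" "y \<notin> Q" "adj x y"
  shows "card {z \<in> Q. adj y z} \<le> m"
proof -
  obtain q where q: "q \<in> Q" "\<not> adj y q"
    using line_maximal assms adj_V by blast
  have "{z \<in> Q. adj y z} \<subseteq> {z. adj q z \<and> adj y z}"
    using q line_clique[OF assms(1)] by (auto simp: clique_def)
  then have "card {z \<in> Q. adj y z} \<le> card {z. adj q z \<and> adj y z}"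
    by (intro card_mono finite_sub_adj)
  also have "\<dots> = m"
  proof (rule common_nonadj)
    have "adj y x" "q \<noteq> x"
      using assms q adj_sym by blast+
    then show "adj q x" "adj y x"
      using q assms line_clique[OF assms(1)] by (auto simp: clique_def)
  qed (use q assms adj_sym in blast)+
  finally show ?thesis .
qed

text \<open>Distinct lines through \<open>x\<close> and \<open>y\<close> would share at most
  \<open>m\<close> points, while all points of their union other than \<open>x\<close> and
  \<open>y\<close> lie among the \<open>l\<close> common neighbours of these two. Their sizes would
  then add up to at most \<open>l + m + 2\<close>.\<close>

lemma line_unique:
  assumes "Q \<in> lines" "Q' \<in> lines" "{x, y} \<subseteq> Q \<inter> Q'" "x \<noteq> y"
  shows "Q = Q'"
proof (rule ccontr)
  assume ne: "Q \<noteq> Q'"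
  have fin: "finite Q" "finite Q'"
    using assms line_clique finite_clique by blast+
  have "\<not> Q \<subseteq> Q'"
  proof
    assume "Q \<subseteq> Q'"
    then obtain z where z: "z \<in> Q'" "z \<notin> Q"
      using ne by blast
    then have "z \<in> V"
      using assms line_clique[OF assms(2)] by (auto simp: clique_def)
    then obtain q where "q \<in> Q" "\<not> adj z q"
      using line_maximal[OF assms(1)] z by blast
    moreover have "q \<in> Q'" "z \<noteq> q"
      using calculation z \<open>Q \<subseteq> Q'\<close> by auto
    ultimately show False
      using z line_clique[OF assms(2)] by (simp add: clique_def)
  qed
  then obtain q where q: "q \<in> Q" "q \<notin> Q'"
    by blast
  have "Q \<inter> Q' \<subseteq> {z \<in> Q'. adj q z}"
    using q line_clique[OF assms(1)] by (auto simp: clique_def)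
  then have "card (Q \<inter> Q') \<le> card {z \<in> Q'. adj q z}"
    using fin by (intro card_mono) auto
  also have "\<dots> \<le> m"
    using q assms line_clique[OF assms(1)]
    by (intro card_line_Int_adj_le[of _ x]) (auto simp: clique_def)
  finally have int: "card (Q \<inter> Q') \<le> m" .
  have "card (Q \<union> Q' - {x, y}) \<le> card {z. adj x z \<and> adj y z}"
    using assms line_clique[OF assms(1)] line_clique[OF assms(2)]
    by (intro card_mono finite_sub_adj) (auto simp: clique_def)
  also have "\<dots> = l"
    using assms line_clique[OF assms(1)] by (intro common_adj) (auto simp: clique_def)
  finally have "card (Q \<union> Q') \<le> l + 2"
    using assms fin by (simp add: card_Diff_subset)
  then have "card Q + card Q' \<le> l + 2 + m"
    using int card_Un_Int[OF fin] by linarith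
  \<comment> \<open>Each line has at least \<open>k - 2 * l - 1\<close> points, so
    \<open>valency_very_large\<close> is violated.\<close>
  then show False
    using line_card_ge[OF assms(1)] line_card_ge[OF assms(2)] valency_very_large
    by (simp add: algebra_simps)
qed

text \<open>By \<open>ex_line\<close> and \<open>line_unique\<close>, the lines through
  \<open>x\<close>, with \<open>x\<close> removed, partition its neighbourhood.\<close>

lemma sum_lines_through:
  assumes "x \<in> V"
  shows "(\<Sum>Q \<in> {Q \<in> lines. x \<in> Q}. card Q - 1) = k"
proof -
  have "{y. adj x y} = (\<Union>Q \<in> {Q \<in> lines. x \<in> Q}. Q - {x})"
    using ex_line[of x] adj_irrefl line_clique by (fastforce simp: clique_def)
  also have "card \<dots> = (\<Sum>Q \<in> {Q \<in> lines. x \<in> Q}. card (Q - {x}))"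
  proof (intro card_UN_disjoint ballI impI)
    show "(Q - {x}) \<inter> (Q' - {x}) = {}"
      if "Q \<in> {Q \<in> lines. x \<in> Q}" "Q' \<in> {Q \<in> lines. x \<in> Q}" "Q \<noteq> Q'" for Q Q'
      using that line_unique[of Q Q' x] by blast
  qed (use finite_lines line_clique finite_clique in auto)
  also have "\<dots> = (\<Sum>Q \<in> {Q \<in> lines. x \<in> Q}. card Q - 1)"
    using line_clique finite_clique by (intro sum.cong) auto
  finally show ?thesis
    using valency[OF assms] by simp
qed

definition lines_of_size :: "nat \<Rightarrow> 'a \<Rightarrow> nat" where
  "lines_of_size s x = card {Q \<in> lines. x \<in> Q \<and> card Q = s}"

text \<open>Double counting of incident point-line pairs; the factor \<open>s\<close> is the source
  of the divisibility conditions.\<close>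

lemma sum_lines_of_size:
  "(\<Sum>x\<in>V. lines_of_size s x) = s * card {Q \<in> lines. card Q = s}"
proof -
  have "(\<Sum>x\<in>V. card {Q \<in> {Q \<in> lines. card Q = s}. x \<in> Q}) = s * card {Q \<in> lines. card Q = s}"
    using finite_V finite_lines line_clique by (intro sum_card_incident_eq) (auto simp: clique_def)
  then show ?thesis
    by (simp add: lines_of_size_def conj_ac)
qed

text \<open>The range comes from \<open>line_card_ge\<close> and \<open>line_card_le\<close>; its
  lower end is not truncated, by \<open>valency_large\<close>.\<close>

lemma sum_by_size:
  "(\<Sum>Q \<in> {Q \<in> lines. x \<in> Q}. f (card Q)) =
    (\<Sum>s = k - 2 * l - 1..l + 2. f s * lines_of_size s x)"
proof -
  have "(\<Sum>Q \<in> {Q \<in> lines. x \<in> Q}. f (card Q)) =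
      (\<Sum>s = k - 2 * l - 1..l + 2. \<Sum>Q \<in> {Q \<in> {Q \<in> lines. x \<in> Q}. card Q = s}. f (card Q))"
    using line_card_le line_card_ge by (intro sum.group[symmetric]) (fastforce simp: finite_lines)+
  also have "\<dots> = (\<Sum>s = k - 2 * l - 1..l + 2. f s * lines_of_size s x)"
    by (intro sum.cong) (auto simp: lines_of_size_def conj_ac mult.commute)
  finally show ?thesis .
qed

lemma lines_through_by_size:
  "x \<in> V \<Longrightarrow> (\<Sum>s = k - 2 * l - 1..l + 2. (s - 1) * lines_of_size s x) = k"
  using sum_lines_through[of x] sum_by_size[of "\<lambda>s. s - 1" x] by simp

text \<open>
  A point \<open>y \<noteq> x\<close> of \<open>L\<close> has at most \<open>m - 1\<close> neighbours on \<open>Q - {x}\<close> for every further line \<open>Q\<close>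
  through \<open>x\<close>, and none if \<open>Q\<close> has \<open>l + 2\<close> points.
\<close>
lemma lines_meeting_short_line:
  assumes "L \<in> lines" "x \<in> L" "card L < l + 2"
  shows "l + 2 + (m - 1) * (1 + lines_of_size (l + 2) x) \<le>
    card L + (m - 1) * card {Q \<in> lines. x \<in> Q}"
proof -
  define R where "R = {Q \<in> lines. x \<in> Q}"
  define F where "F = {Q \<in> lines. x \<in> Q \<and> card Q = l + 2}"
  define R' where "R' = R - F - {L}"
  have finR: "finite R" "finite F" "finite R'"
    using finite_lines by (auto simp: R_def F_def R'_def)
  have clL: "clique L" "finite L"
    using assms line_clique finite_clique by blast+
  have "1 < card L"
    using line_card_ge[OF assms(1)] valency_large by linarith
  then obtain y where y: "y \<in> L" "y \<noteq> x"
    by (metis card_le_Suc0_iff_eq clL(2) assms(2) not_less One_nat_def)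
  have xy: "adj x y"
    using y assms clL by (auto simp: clique_def)
  have notin: "y \<notin> Q" if "Q \<in> R" "Q \<noteq> L" for Q
    using line_unique[of Q L x y] that y assms by (auto simp: R_def)
  \<comment> \<open>A line with \<open>l + 2\<close> points already contains all \<open>l\<close>
    common neighbours of \<open>x\<close> and \<open>z\<close>. If \<open>y\<close> were adjacent to
    \<open>z\<close>, it would be one of them and lie on \<open>Q\<close>, contrary to the
    uniqueness of \<open>L\<close>.\<close>
  have F_none: "\<not> adj y z" if "Q \<in> F" "z \<in> Q" "z \<noteq> x" for Q z
  proof
    assume yz: "adj y z"
    have Q: "Q \<in> lines" "x \<in> Q" "card Q = l + 2" "clique Q" "finite Q"
      using that line_clique finite_clique by (auto simp: F_def)
    have "card (Q - {x, z}) = l"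
      using Q that by (simp add: card_Diff_subset)
    moreover have "card {w. adj x w \<and> adj z w} = l"
      using Q that by (intro common_adj) (auto simp: clique_def)
    moreover have "Q - {x, z} \<subseteq> {w. adj x w \<and> adj z w}"
      using Q that by (auto simp: clique_def)
    ultimately have "Q - {x, z} = {w. adj x w \<and> adj z w}"
      by (intro card_subset_eq finite_sub_adj) auto
    then have "y \<in> Q"
      using xy yz adj_sym by blast
    moreover have "Q \<noteq> L"
      using Q assms by auto
    ultimately show False
      using notin[of Q] Q by (auto simp: R_def)
  qed
  have small: "card {z \<in> Q - {x}. adj y z} \<le> m - 1" if "Q \<in> R'" for Q
  proof -
    have Q: "Q \<in> lines" "x \<in> Q" "y \<notin> Q" "finite Q"
      using that notin[of Q] line_clique finite_clique by (auto simp: R_def R'_def)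
    have "{z \<in> Q - {x}. adj y z} = {z \<in> Q. adj y z} - {x}"
      by auto
    moreover have "x \<in> {z \<in> Q. adj y z}"
      using Q xy adj_sym by blast
    ultimately show ?thesis
      using card_line_Int_adj_le[OF Q(1-3) xy] Q by simp
  qed
  \<comment> \<open>The common neighbours of \<open>x\<close> and \<open>y\<close> are distributed
    over the lines through \<open>x\<close>: \<open>card L - 2\<close> on \<open>L\<close>, none on
    lines of \<open>F\<close>, at most \<open>m - 1\<close> on each line of
    \<open>R'\<close>.\<close>
  have "l = card {z. adj x z \<and> adj y z}"
    using xy common_adj by simp
  also have "\<dots> \<le> card ((L - {x, y}) \<union> (\<Union>Q\<in>R'. {z \<in> Q - {x}. adj y z}))"
  proof (intro card_mono)
    show "{z. adj x z \<and> adj y z} \<subseteq> (L - {x, y}) \<union> (\<Union>Q\<in>R'. {z \<in> Q - {x}. adj y z})"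
    proof
      fix z
      assume "z \<in> {z. adj x z \<and> adj y z}"
      then have z: "adj x z" "adj y z" "z \<noteq> x" "z \<noteq> y"
        using adj_irrefl by auto
      then obtain Q where Q: "Q \<in> lines" "x \<in> Q" "z \<in> Q"
        using ex_line by blast
      then have "Q \<notin> F"
        using F_none z by blast
      then show "z \<in> (L - {x, y}) \<union> (\<Union>Q\<in>R'. {z \<in> Q - {x}. adj y z})"
        using Q z by (auto simp: R_def R'_def)
    qed
  qed (use clL finR line_clique finite_clique in \<open>auto simp: R_def R'_def\<close>)
  also have "\<dots> \<le> card (L - {x, y}) + card (\<Union>Q\<in>R'. {z \<in> Q - {x}. adj y z})"
    by (rule card_Un_le)
  also have "card (\<Union>Q\<in>R'. {z \<in> Q - {x}. adj y z}) \<le> (\<Sum>Q\<in>R'. card {z \<in> Q - {x}. adj y z})"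
    using finR by (intro card_UN_le)
  also have "\<dots> \<le> card R' * (m - 1)"
    using small by (intro order.trans[OF sum_bounded_above[of _ _ "m - 1"]]) auto
  finally have "l \<le> card (L - {x, y}) + card R' * (m - 1)"
    by simp
  moreover have "card (L - {x, y}) + 2 = card L"
    using \<open>1 < card L\<close> clL y assms by (simp add: card_Diff_subset)
  \<comment> \<open>The \<open>1\<close> counts \<open>L\<close>, which is too short to belong to
    \<open>F\<close>.\<close>
  moreover have "card R = card R' + card F + 1"
  proof -
    have "R = insert L (R' \<union> F)" "L \<notin> R' \<union> F" "R' \<inter> F = {}"
      using assms by (auto simp: R_def R'_def F_def)
    then show ?thesis
      using finR by (simp add: card_Un_disjoint)
  qed
  ultimately show ?thesis
    unfolding R_def[symmetric] lines_of_size_def F_def[symmetric]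
    by (simp add: algebra_simps)
qed

end


section \<open>Path distance as a natural number\<close>

text \<open>Meaningful only when \<open>y\<close> is reachable from \<open>x\<close>; otherwise
  \<open>LEAST\<close> is unspecified, hence the reachability hypotheses below.\<close>

definition (in wf_digraph) hop_dist :: "'a \<Rightarrow> 'a \<Rightarrow> nat" where
  "hop_dist x y = (LEAST n. \<exists>p. awalk x p y \<and> length p = n)"

context wf_digraph
begin

lemma awalk_cost_1 [simp]: "awalk_cost (\<lambda>_. 1) p = real (length p)"
  by (induction p) auto

lemma hop_dist_le: "awalk x p y \<Longrightarrow> hop_dist x y \<le> length p"
  unfolding hop_dist_def by (rule Least_le) blast

lemma hop_dist_awalk:
  assumes "x \<rightarrow>\<^sup>* y"
  obtains p where "awalk x p y" "length p = hop_dist x y"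
proof -
  have "\<exists>p. awalk x p y \<and> length p = hop_dist x y"
    using LeastI_ex[of "\<lambda>n. \<exists>p. awalk x p y \<and> length p = n"] assms
    by (auto simp: hop_dist_def reachable_awalk)
  then show ?thesis
    using that by blast
qed

text \<open>With unit weights the infimum over walks is attained by a shortest one.\<close>

lemma graph_dist_eq_hop_dist:
  assumes "x \<rightarrow>\<^sup>* y"
  shows "graph_dist G x y = ereal (real (hop_dist x y))"
proof (rule antisym)
  obtain p where "awalk x p y" "length p = hop_dist x y"
    using hop_dist_awalk[OF assms] .
  then show "graph_dist G x y \<le> ereal (real (hop_dist x y))"
    unfolding graph_dist_def using min_cost_le_walk_cost[of x p y "\<lambda>_. 1"] by simp
  show "ereal (real (hop_dist x y)) \<le> graph_dist G x y"
    unfolding graph_dist_def \<mu>_def by (auto intro!: INF_greatest hop_dist_le)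
qed

lemma hop_dist_self [simp]: "x \<in> verts G \<Longrightarrow> hop_dist x x = 0"
  using hop_dist_le[of x "[]" x] by (simp add: awalk_Nil_iff)

lemma hop_dist_eq_0:
  assumes "x \<rightarrow>\<^sup>* y" "hop_dist x y = 0"
  shows "x = y"
  using hop_dist_awalk[OF assms(1)] assms(2) by (metis awalk_Nil_iff length_0_conv)

lemma hop_dist_eq_1:
  assumes "x \<rightarrow>\<^sup>* y" "hop_dist x y = 1"
  shows "x \<rightarrow> y"
proof -
  obtain p where p: "awalk x p y" "length p = 1"
    using hop_dist_awalk[OF assms(1)] assms(2) by metis
  then obtain e where "p = [e]"
    by (auto simp: length_Suc_conv)
  with p(1) show ?thesis
    by (auto simp: awalk_simps in_arcs_imp_in_arcs_ends)
qed

lemma hop_dist_step: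
  assumes "x \<rightarrow>\<^sup>* y" "y \<rightarrow> z"
  shows "hop_dist x z \<le> Suc (hop_dist x y)"
proof -
  obtain p where p: "awalk x p y" "length p = hop_dist x y"
    using hop_dist_awalk[OF assms(1)] .
  obtain e where "e \<in> arcs G" "tail G e = y" "head G e = z"
    using assms(2) by blast
  then have "awalk y [e] z"
    using arc_implies_awalk by blast
  then have "awalk x (p @ [e]) z"
    using p(1) awalk_appendI by blast
  then show ?thesis
    using hop_dist_le[of x "p @ [e]" z] p(2) by simp
qed

end

section \<open>Distance-regular graphs: spheres and ample regularity\<close>

locale distance_regular_graph = graph G for G :: "('a, 'b) pre_digraph" (structure) +
  fixes b c :: "nat \<Rightarrow> nat"
  assumes reach: "\<lbrakk>x \<in> verts G; y \<in> verts G\<rbrakk> \<Longrightarrow> x \<rightarrow>\<^sup>* y"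
    and inums: "intersection_numbers G b c"
begin

lemma adj_commute: "x \<rightarrow> y \<longleftrightarrow> y \<rightarrow> x"
  using arcs_ends_symmetric[OF sym_arcs] by blast

lemma adj_irrefl [simp]: "\<not> x \<rightarrow> x"
  using adj_not_same by blast

lemma graph_dist_hop:
  "\<lbrakk>x \<in> verts G; y \<in> verts G\<rbrakk> \<Longrightarrow> graph_dist G x y = ereal (real (hop_dist x y))"
  using graph_dist_eq_hop_dist reach by blast

lemma hop_dist_eq_1_iff:
  assumes "x \<in> verts G" "y \<in> verts G"
  shows "hop_dist x y = 1 \<longleftrightarrow> x \<rightarrow> y"
proof
  assume xy: "x \<rightarrow> y"
  then have "hop_dist x y \<le> 1"
    using hop_dist_step[of x x y] assms by simp
  moreover have "hop_dist x y \<noteq> 0"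
    using hop_dist_eq_0[OF reach] assms xy by fastforce
  ultimately show "hop_dist x y = 1"
    by simp
qed (use hop_dist_eq_1 reach assms in blast)

lemma card_away:
  assumes "x \<in> verts G" "y \<in> verts G"
  shows "card {z \<in> verts G. y \<rightarrow> z \<and> hop_dist x z = Suc (hop_dist x y)} = b (hop_dist x y)"
proof -
  have "{z \<in> verts G. y \<rightarrow> z \<and> hop_dist x z = Suc (hop_dist x y)} =
      {z \<in> verts G. y \<rightarrow> z \<and> graph_dist G x z = ereal (real (hop_dist x y) + 1)}"
    using assms by (auto simp: graph_dist_hop)
  then show ?thesis
    using inums assms graph_dist_hop by (simp add: intersection_numbers_def)
qed

text \<open>The distance is taken as \<open>Suc i\<close> so that its predecessor needs no
  subtraction.\<close>

lemma card_towards: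
  assumes "x \<in> verts G" "y \<in> verts G" "hop_dist x y = Suc i"
  shows "card {z \<in> verts G. y \<rightarrow> z \<and> hop_dist x z = i} = c (Suc i)"
proof -
  have "{z \<in> verts G. y \<rightarrow> z \<and> hop_dist x z = i} =
      {z \<in> verts G. y \<rightarrow> z \<and> graph_dist G x z = ereal (real (Suc i) - 1)}"
    using assms by (auto simp: graph_dist_hop)
  then show ?thesis
    using inums assms graph_dist_hop[OF assms(1,2)]
    by (simp only: intersection_numbers_def)
qed

definition sphere :: "'a \<Rightarrow> nat \<Rightarrow> 'a set" where
  "sphere x i = {y \<in> verts G. hop_dist x y = i}"

lemma finite_sphere: "finite (sphere x i)"
  by (simp add: sphere_def)

lemma sphere_0: "x \<in> verts G \<Longrightarrow> sphere x 0 = {x}"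
  using hop_dist_eq_0[OF reach] by (auto simp: sphere_def)

text \<open>Double counting of the edges between consecutive spheres.\<close>

lemma card_sphere_Suc:
  assumes "x \<in> verts G"
  shows "card (sphere x i) * b i = card (sphere x (Suc i)) * c (Suc i)"
proof -
  have outward: "card {z \<in> sphere x (Suc i). y \<rightarrow> z} = b i" if "y \<in> sphere x i" for y
  proof -
    have "{z \<in> sphere x (Suc i). y \<rightarrow> z} = {z \<in> verts G. y \<rightarrow> z \<and> hop_dist x z = Suc (hop_dist x y)}"
      using that by (auto simp: sphere_def)
    then show ?thesis
      using card_away[OF assms, of y] that by (simp add: sphere_def)
  qed
  have inward: "card {y \<in> sphere x i. y \<rightarrow> z} = c (Suc i)" if "z \<in> sphere x (Suc i)" for z
  proof -
    have "{y \<in> sphere x i. y \<rightarrow> z} = {y \<in> verts G. z \<rightarrow> y \<and> hop_dist x y = i}"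
      using adj_commute by (auto simp: sphere_def)
    then show ?thesis
      using card_towards[OF assms, of z i] that by (simp add: sphere_def)
  qed
  have "(\<Sum>y\<in>sphere x i. card {z \<in> sphere x (Suc i). y \<rightarrow> z}) = (\<Sum>z\<in>sphere x (Suc i). c (Suc i))"
    using inward by (intro sum_multicount_gen finite_sphere) blast
  then show ?thesis
    using outward by simp
qed

lemma hop_dist_le_diameter:
  assumes "graph_diameter G = ereal (real D)" "x \<in> verts G" "y \<in> verts G"
  shows "hop_dist x y \<le> D"
proof -
  have "graph_dist G x y \<le> graph_diameter G"
    unfolding graph_diameter_def using assms by (intro SUP_upper2[of x] SUP_upper) auto
  then show ?thesis
    using assms graph_dist_hop by simp
qed

lemma card_verts:
  assumes "graph_diameter G = ereal (real D)" "x \<in> verts G"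
  shows "card (verts G) = (\<Sum>i\<le>D. card (sphere x i))"
proof -
  have "verts G = (\<Union>i\<le>D. sphere x i)"
    using hop_dist_le_diameter[OF assms] by (auto simp: sphere_def)
  then have "card (verts G) = card (\<Union>i\<le>D. sphere x i)"
    by simp
  also have "\<dots> = (\<Sum>i\<le>D. card (sphere x i))"
    by (rule card_UN_disjoint) (auto simp: sphere_def)
  finally show ?thesis .
qed

text \<open>For adjacent \<open>x\<close> and \<open>y\<close>, the neighbours of \<open>y\<close>
  lie at distance 0, 1 or 2 from \<open>x\<close>; the outer classes have \<open>c 1 = 1\<close> and
  \<open>b 1\<close> points, which leaves \<open>b 0 - b 1 - 1\<close> common neighbours. At
  distance two, the common neighbours are the neighbours of \<open>y\<close> one step closer to
  \<open>x\<close>.\<close>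

lemma amply_regular:
  assumes "c 1 = 1"
  shows "amply_regular (verts G) (dominates G) (b 0) (b 0 - b 1 - 1) (c 2)"
proof
  show "finite (verts G)"
    by simp
  show "y \<in> verts G" if "x \<rightarrow> y" for x y
    using that adj_in_verts by blast
  show "y \<rightarrow> x" if "x \<rightarrow> y" for x y
    using that adj_commute by blast
  show "\<not> x \<rightarrow> x" for x
    by simp
  have val: "card {y. x \<rightarrow> y} = b 0" if "x \<in> verts G" for x
  proof -
    have "{y. x \<rightarrow> y} = {y \<in> verts G. x \<rightarrow> y \<and> hop_dist x y = Suc (hop_dist x x)}"
      using that hop_dist_eq_1_iff[of x] adj_in_verts by auto
    then show ?thesis
      using card_away[OF that that] that by simp
  qed
  then show "card {y. x \<rightarrow> y} = b 0" if "x \<in> verts G" for x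
    using that by blast
  show "card {z. x \<rightarrow> z \<and> y \<rightarrow> z} = b 0 - b 1 - 1" if xy: "x \<rightarrow> y" for x y
  proof -
    have V: "x \<in> verts G" "y \<in> verts G"
      using xy adj_in_verts by blast+
    have d: "hop_dist x y = Suc 0"
      using hop_dist_eq_1_iff[OF V] xy by simp
    define A where "A i = {z \<in> verts G. y \<rightarrow> z \<and> hop_dist x z = i}" for i
    have A1: "A 1 = {z. x \<rightarrow> z \<and> y \<rightarrow> z}"
      using V hop_dist_eq_1_iff[of x] adj_in_verts by (auto simp: A_def)
    have "hop_dist x z \<le> 2" if "y \<rightarrow> z" for z
      using hop_dist_step[OF reach[OF V] that] d by simp
    then have "{z. y \<rightarrow> z} = A 0 \<union> A 1 \<union> A 2"
      using adj_in_verts by (fastforce simp: A_def)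
    moreover have "finite (A i)" for i
      by (simp add: A_def)
    moreover have "A i \<inter> A j = {}" if "i \<noteq> j" for i j
      using that by (auto simp: A_def)
    ultimately have "card {z. y \<rightarrow> z} = card (A 0) + card (A 1) + card (A 2)"
      by (simp add: card_Un_disjoint Int_Un_distrib2)
    moreover have "card (A 0) = 1"
      using card_towards[OF V d] assms by (simp add: A_def)
    moreover have "card (A 2) = b 1"
      using card_away[OF V] d by (simp add: A_def numeral_2_eq_2)
    ultimately show ?thesis
      using val[OF V(2)] A1 by simp
  qed
  show "card {z. x \<rightarrow> z \<and> y \<rightarrow> z} = c 2"
    if xy: "x \<noteq> y" "\<not> x \<rightarrow> y" and w: "x \<rightarrow> w" "y \<rightarrow> w" for x y w
  proof -
    have V: "x \<in> verts G" "y \<in> verts G" "w \<in> verts G"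
      using w adj_in_verts by blast+
    have "w \<rightarrow> y"
      using w adj_commute by blast
    then have "hop_dist x y \<le> 2"
      using hop_dist_step[OF reach[OF V(1,3)], of y] w(1) hop_dist_eq_1_iff[OF V(1,3)] by simp
    moreover have "hop_dist x y \<noteq> 0"
      using hop_dist_eq_0[OF reach[OF V(1,2)]] xy by blast
    moreover have "hop_dist x y \<noteq> 1"
      using hop_dist_eq_1_iff[OF V(1,2)] xy by blast
    ultimately have "hop_dist x y = Suc 1"
      by linarith
    moreover have "{z. x \<rightarrow> z \<and> y \<rightarrow> z} = {z \<in> verts G. y \<rightarrow> z \<and> hop_dist x z = 1}"
      using hop_dist_eq_1_iff[OF V(1)] adj_in_verts by auto
    ultimately show ?thesis
      using card_towards[OF V(1,2), of 1] by (simp add: numeral_2_eq_2)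
  qed
qed

end

section \<open>From intersection arrays to the combinatorial locales\<close>

text \<open>The second list starts with \<open>c 1\<close>, hence the index shift. Connectedness
  becomes mutual reachability because all arcs come in opposite pairs.\<close>

lemma has_intersection_arrayE:
  assumes "distance_regular G" "has_intersection_array G bs cs"
  obtains b c where "distance_regular_graph G b c" "graph_diameter G = ereal (real (length bs))"
    "\<forall>i<length bs. b i = bs ! i" "\<forall>i<length cs. c (Suc i) = cs ! i"
    "verts G \<noteq> {}"
proof -
  obtain D b c where *: "graph_diameter G = ereal (real D)" "intersection_numbers G b c"
    "bs = map b [0..<D]" "cs = map c [1..<Suc D]"
    using assms(2) unfolding has_intersection_array_def by blast
  have G: "graph G" "Digraph_Component.connected G"
    using assms(1) by (simp_all add: distance_regular_def)
  interpret graph G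
    by (rule G(1))
  have sc: "strongly_connected G"
    using G(2) symmetric_connected_imp_strongly_connected sym_arcs by blast
  have "distance_regular_graph G b c"
    by unfold_locales (use sc *(2) in \<open>auto simp: strongly_connected_def\<close>)
  moreover have "verts G \<noteq> {}"
    using sc by (simp add: strongly_connected_def)
  moreover have "c (Suc i) = cs ! i" if "i < length cs" for i
    using that *(4) by (simp del: upt_Suc)
  ultimately show ?thesis
    using * that by simp
qed

text \<open>Here \<open>l + 1 = k - b1\<close>. Only the first two entries of each half of the array
  matter, so arrays of diameter 3 and 4 are treated alike.\<close>

lemma valency_le_if_coclique_free:
  assumes "distance_regular G" "has_intersection_array G (k # b1 # bs) (1 # m # cs)"
    and "k + 6 * (m - 1) < 4 * (k - b1)" "2 * (k - b1) < k" "b1 < k"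
  shows "k \<le> 3 * (k - b1)"
proof -
  obtain b c where "distance_regular_graph G b c"
    and "graph_diameter G = ereal (real (length (k # b1 # bs)))"
    and b: "\<forall>i<length (k # b1 # bs). b i = (k # b1 # bs) ! i"
    and c: "\<forall>i<length (1 # m # cs). c (Suc i) = (1 # m # cs) ! i"
    and V: "verts G \<noteq> {}"
    using has_intersection_arrayE[OF assms(1,2)] .
  then interpret distance_regular_graph G b c
    by simp
  have p: "b 0 = k" "b 1 = b1" "c 1 = 1" "c 2 = m"
    using b[rule_format, of 0] b[rule_format, of 1] c[rule_format, of 0] c[rule_format, of 1]
    by (simp_all add: numeral_2_eq_2)
  interpret coclique_free_amply_regular "verts G" "dominates G" k "k - b1 - 1" m
    using amply_regular p assms(3-5)
    by (intro coclique_free_amply_regular.intro coclique_free_amply_regular_axioms.intro) auto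
  show ?thesis
    using valency_le[OF V] assms(5) by simp
qed

text \<open>In the second conclusion \<open>k2\<close> and \<open>k3\<close> are the sizes of the
  spheres of radius 2 and 3; the array thus determines the number of vertices.\<close>

lemma linear_amply_regular_if_diameter_3:
  assumes "distance_regular G" "has_intersection_array G [k, b1, b2] [1, m, c3]"
    and "k + 6 * (m - 1) < 4 * (k - b1)" "2 * (k - b1) < k" "b1 < k"
    and "5 * (k - b1 - 1) + m + 4 < 2 * k"
  shows "linear_amply_regular (verts G) (dominates G) k (k - b1 - 1) m"
    and "\<exists>k2 k3. k * b1 = k2 * m \<and> k2 * b2 = k3 * c3 \<and> card (verts G) = 1 + k + k2 + k3"
proof -
  obtain b c where "distance_regular_graph G b c"
    and D: "graph_diameter G = ereal (real (length [k, b1, b2]))"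
    and b: "\<forall>i<length [k, b1, b2]. b i = [k, b1, b2] ! i"
    and c: "\<forall>i<length [1, m, c3]. c (Suc i) = [1, m, c3] ! i"
    and V: "verts G \<noteq> {}"
    using has_intersection_arrayE[OF assms(1,2)] .
  then interpret distance_regular_graph G b c
    by simp
  have p: "b 0 = k" "b 1 = b1" "b 2 = b2" "c 1 = 1" "c 2 = m" "c 3 = c3"
    using b[rule_format, of 0] b[rule_format, of 1] b[rule_format, of 2]
      c[rule_format, of 0] c[rule_format, of 1] c[rule_format, of 2]
    by (simp_all add: numeral_2_eq_2 numeral_3_eq_3)
  show "linear_amply_regular (verts G) (dominates G) k (k - b1 - 1) m"
    using amply_regular p assms(3-6)
    by (intro linear_amply_regular.intro linear_amply_regular_axioms.intro
        coclique_free_amply_regular.intro coclique_free_amply_regular_axioms.intro) auto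
  obtain x where x: "x \<in> verts G"
    using V by blast
  have "card (sphere x 1) = k"
    using card_sphere_Suc[OF x, of 0] p x by (simp add: sphere_0)
  moreover have "card (sphere x 1) * b1 = card (sphere x 2) * m"
    using card_sphere_Suc[OF x, of 1] p by (simp add: numeral_2_eq_2)
  moreover have "card (sphere x 2) * b2 = card (sphere x 3) * c3"
    using card_sphere_Suc[OF x, of 2] p by (simp add: numeral_2_eq_2 numeral_3_eq_3)
  moreover have "card (verts G) = 1 + card (sphere x 1) + card (sphere x 2) + card (sphere x 3)"
    using card_verts[OF D x] x by (simp add: numeral_2_eq_2 numeral_3_eq_3 sphere_0)
  ultimately show
    "\<exists>k2 k3. k * b1 = k2 * m \<and> k2 * b2 = k3 * c3 \<and> card (verts G) = 1 + k + k2 + k3"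
    by metis
qed

section \<open>Counting lines by size for the arrays (i) and (ii)\<close>

text \<open>Lines have 18, 19 or 20 points. As \<open>55 = 3 * 18 + 1\<close>, the three lines
  through a point have sizes 19, 19, 20 or 18, 20, 20.\<close>

lemma card_ne_672:
  assumes "linear_amply_regular V adj 55 18 4"
  shows "card V \<noteq> 672"
proof
  assume V: "card V = 672"
  interpret linear_amply_regular V adj 55 18 4
    by (rule assms)
  have range: "{18..20::nat} = {18, 19, 20}"
    by auto
  define n where "n s = card {Q \<in> lines. card Q = s}" for s
  have "lines_of_size 20 x = lines_of_size 18 x + 1 \<and>
      lines_of_size 19 x + 2 * lines_of_size 18 x = 2" if "x \<in> V" for x
  proof -
    have *: "17 * lines_of_size 18 x + 18 * lines_of_size 19 x + 19 * lines_of_size 20 x = 55"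
      using lines_through_by_size[OF that] by (simp add: range)
    \<comment> \<open>Two lines cover at most 38 neighbours, and four at least 68.\<close>
    then have "lines_of_size 18 x + lines_of_size 19 x + lines_of_size 20 x = 3"
      by linarith
    with * show ?thesis
      by linarith
  qed
  then have "(\<Sum>x\<in>V. lines_of_size 20 x) = (\<Sum>x\<in>V. lines_of_size 18 x + 1)"
    "(\<Sum>x\<in>V. lines_of_size 19 x + 2 * lines_of_size 18 x) = (\<Sum>x\<in>V. 2)"
    by (auto intro: sum.cong)
  then have n: "20 * n 20 = 18 * n 18 + 672" "19 * n 19 + 36 * n 18 = 1344"
    unfolding sum.distrib sum_distrib_left[symmetric] sum_lines_of_size n_def[symmetric]
    using V by simp_all
  \<comment> \<open>The first equation forces \<open>n 18\<close> to be 6 modulo 10;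
    \<open>u\<close> is the quotient, written as a linear term.\<close>
  define u where "u = 33 + n 18 - n 20"
  have "n 18 = 10 * u + 6"
    using n(1) unfolding u_def by linarith
  with n(2) have u: "19 * n 19 + 360 * u = 1128"
    by linarith
  then have "19 dvd 1128 - 360 * u"
    by (metis diff_add_inverse2 dvd_triv_left)
  moreover have "u = 0 \<or> u = 1 \<or> u = 2 \<or> u = 3"
    using u by linarith
  ultimately show False
    by auto
qed

text \<open>Lines have 17 to 21 points, again three through each point. Once sizes 17 and 18 are
  excluded, \<open>56 = 3 * 18 + 2\<close> leaves the sizes 19, 20, 20 or 19, 19, 21.\<close>

lemma card_ne_855:
  assumes "linear_amply_regular V adj 56 19 3"
  shows "card V \<noteq> 855"
proof
  assume V: "card V = 855"
  interpret linear_amply_regular V adj 56 19 3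
    by (rule assms)
  have range: "{17..21::nat} = {17, 18, 19, 20, 21}"
    by auto
  define n where "n s = card {Q \<in> lines. card Q = s}" for s
  have "lines_of_size 19 x = lines_of_size 21 x + 1 \<and>
      lines_of_size 20 x + 2 * lines_of_size 21 x = 2" if x: "x \<in> V" for x
  proof -
    have sum: "16 * lines_of_size 17 x + 17 * lines_of_size 18 x + 18 * lines_of_size 19 x +
        19 * lines_of_size 20 x + 20 * lines_of_size 21 x = 56"
      using lines_through_by_size[OF x] by (simp add: range)
    have num: "card {Q \<in> lines. x \<in> Q} = lines_of_size 17 x + lines_of_size 18 x +
        lines_of_size 19 x + lines_of_size 20 x + lines_of_size 21 x"
      using sum_by_size[of "\<lambda>_. 1" x] by (simp add: range)
    then have three: "card {Q \<in> lines. x \<in> Q} = 3"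
      using sum by linarith
    have short: "21 + 2 * (1 + lines_of_size 21 x) \<le> s + 6" if "lines_of_size s x \<noteq> 0" "s < 21" for s
    proof -
      have "{Q \<in> lines. x \<in> Q \<and> card Q = s} \<noteq> {}"
        using that unfolding lines_of_size_def by (metis card.empty)
      then obtain L where "L \<in> lines" "x \<in> L" "card L = s"
        by blast
      then show ?thesis
        using lines_meeting_short_line[of L x] three that by simp
    qed
    \<comment> \<open>A line of size 17 or 18 excludes one of size 21 by \<open>short\<close>. The
      total 56 would then require at least three lines of size 20 besides the short one.\<close>
    have "lines_of_size 17 x = 0"
      using short[of 17] sum num three by (cases "lines_of_size 17 x") auto
    moreover have "lines_of_size 18 x = 0"
      using short[of 18] sum num three by (cases "lines_of_size 18 x") auto
    ultimately show ?thesis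
      using sum num three by linarith
  qed
  then have "(\<Sum>x\<in>V. lines_of_size 19 x) = (\<Sum>x\<in>V. lines_of_size 21 x + 1)"
    "(\<Sum>x\<in>V. lines_of_size 20 x + 2 * lines_of_size 21 x) = (\<Sum>x\<in>V. 2)"
    by (auto intro: sum.cong)
  then have n: "19 * n 19 = 21 * n 21 + 855" "20 * n 20 + 42 * n 21 = 1710"
    unfolding sum.distrib sum_distrib_left[symmetric] sum_lines_of_size n_def[symmetric]
    using V by simp_all
  \<comment> \<open>As \<open>855 = 19 * 45\<close>, the first equation reads
    \<open>19 * (n 19 - n 21 - 45) = 2 * n 21\<close>, so 19 divides \<open>n 21\<close>. The
    identity \<open>19 - 9 * 2 = 1\<close> yields this linear term for the quotient.\<close>
  define u where "u = n 21 - 9 * (n 19 - n 21 - 45)"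
  have "n 21 = 19 * u"
    using n(1) unfolding u_def by linarith
  with n(2) have u: "20 * n 20 + 798 * u = 1710"
    by linarith
  then have "20 dvd 1710 - 798 * u"
    by (metis diff_add_inverse2 dvd_triv_left)
  moreover have "u = 0 \<or> u = 1 \<or> u = 2"
    using u by linarith
  ultimately show False
    by auto
qed

theorem theorem3p5:
  fixes G :: "('a, 'b) pre_digraph"
  assumes "distance_regular G"
  shows "\<not> has_intersection_array G [55, 36, 11] [1, 4, 45] \<and>
    \<not> has_intersection_array G [56, 36, 9] [1, 3, 48] \<and>
    \<not> has_intersection_array G [65, 44, 11] [1, 4, 55] \<and>
    \<not> has_intersection_array G [81, 56, 24, 1] [1, 3, 56, 81] \<and>
    \<not> has_intersection_array G [117, 80, 32, 1] [1, 4, 80, 117] \<and>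
    \<not> has_intersection_array G [117, 80, 30, 1] [1, 6, 80, 117] \<and>
    \<not> has_intersection_array G [189, 128, 45, 1] [1, 9, 128, 189]"
proof (intro conjI notI)
  assume "has_intersection_array G [55, 36, 11] [1, 4, 45]"
  note * = linear_amply_regular_if_diameter_3[OF assms this]
  have "linear_amply_regular (verts G) (dominates G) 55 18 4"
    using *(1) by simp
  \<comment> \<open>The sphere sizes are 1, 55, 495 and 121.\<close>
  moreover have "card (verts G) = 672"
    using *(2) by auto
  ultimately show False
    using card_ne_672 by blast
next
  assume "has_intersection_array G [56, 36, 9] [1, 3, 48]"
  note * = linear_amply_regular_if_diameter_3[OF assms this]
  have "linear_amply_regular (verts G) (dominates G) 56 19 3"
    using *(1) by simp
  \<comment> \<open>The sphere sizes are 1, 56, 672 and 126.\<close>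
  moreover have "card (verts G) = 855"
    using *(2) by auto
  ultimately show False
    using card_ne_855 by blast
\<comment> \<open>The valencies 65, 81, 117, 117, 189 exceed the bounds 63, 75, 111, 111,
  183.\<close>
qed (drule valency_le_if_coclique_free[OF assms]; simp)+

end
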